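(* Let $\Gamma$ be a finite abelian group with $|\Gamma|\equiv0\pmod4$. Then there exists a connected gcd-graph over $\Gamma$ exhibiting perfect state transfer at time $\frac{\pi}{2}$.
   Context: Transition matrix of a graph with adjacency matrix $A$: $H(t)=\exp(itA)$; the graph exhibits perfect state transfer at $\tau$ if $|H(\tau)_{uv}|=1$ for some distinct vertices $u,v$. $Cay(\Gamma,S)$ ($S$ symmetric): vertex set $\Gamma$, $a\sim b$ iff $a-b\in S$. Gcd-graphs: write $\Gamma=\mathbb Z_{m_1}\oplus\cdots\oplus\mathbb Z_{m_k}$, represent $x_i\in\mathbb Z_{m_i}$ by an integer in $\{0,\dots,m_i-1\}$, use $\gcd(0,n)=n$; for a divisor tuple $\mathbf d$ ($d_i\mid m_i$) put $S_\Gamma(\mathbf d)=\{\mathbf x:\gcd(x_i,m_i)=d_i\ \forall i\}$, and for a set $\mathbf D$ of divisor tuples $S_\Gamma(\mathbf D)=\bigcup_{\mathbf d\in\mathbf D}S_\Gamma(\mathbf d)$. A gcd-graph over $\Gamma$ is $Cay(\Gamma,S_\Gamma(\mathbf D))$. *)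

theory Defs
  imports
    Complex_Main
    "HOL-Algebra.Product_Groups"
    "HOL-Algebra.Elementary_Groups"
    "Graph_Theory.Graph_Theory"
begin

text \<open>
  The finite abelian group is an arbitrary HOL-Algebra group in multiplicative notation, so the
  difference of a and b reads a times the inverse of b.
\<close>

definition cayley_graph :: "('a, 'b) monoid_scheme \<Rightarrow> 'a set \<Rightarrow> 'a pair_pre_digraph" where
  "cayley_graph G S =
    \<lparr> pverts = carrier G,
      parcs = {(a, b). a \<in> carrier G \<and> b \<in> carrier G \<and> a \<otimes>\<^bsub>G\<^esub> inv\<^bsub>G\<^esub> b \<in> S} \<rparr>"

text \<open>
  A way of writing the group as a direct sum of cyclic groups: a list of moduli together with an
  isomorphism. The coordinates of an element are the standard representatives \<open>0, \<dots>, m - 1\<close>.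
  The modulus 0 is excluded because \<^const>\<open>integer_mod_group\<close> 0 is the group of all integers.
\<close>

definition cyclic_decomposition ::
    "('a, 'b) monoid_scheme \<Rightarrow> nat list \<Rightarrow> ('a \<Rightarrow> nat \<Rightarrow> int) \<Rightarrow> bool" where
  "cyclic_decomposition G ms \<phi> \<longleftrightarrow>
    0 \<notin> set ms \<and>
    \<phi> \<in> iso G (product_group {..<length ms} (\<lambda>i. integer_mod_group (ms ! i)))"

definition divisor_tuples :: "nat list \<Rightarrow> nat list set" where
  "divisor_tuples ms = {ds. length ds = length ms \<and> (\<forall>i<length ms. ds ! i dvd ms ! i)}"

definition gcd_class ::
    "('a, 'b) monoid_scheme \<Rightarrow> nat list \<Rightarrow> ('a \<Rightarrow> nat \<Rightarrow> int) \<Rightarrow> nat list \<Rightarrow> 'a set" where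
  "gcd_class G ms \<phi> ds =
    {x \<in> carrier G. \<forall>i<length ms. gcd (\<phi> x i) (int (ms ! i)) = int (ds ! i)}"

definition gcd_graph ::
    "('a, 'b) monoid_scheme \<Rightarrow> nat list \<Rightarrow> ('a \<Rightarrow> nat \<Rightarrow> int) \<Rightarrow> nat list set \<Rightarrow> 'a pair_pre_digraph"
  where "gcd_graph G ms \<phi> D = cayley_graph G (\<Union>ds\<in>D. gcd_class G ms \<phi> ds)"

definition adjacency_matrix :: "'a pair_pre_digraph \<Rightarrow> 'a \<Rightarrow> 'a \<Rightarrow> complex" where
  "adjacency_matrix X u v = (if (u, v) \<in> parcs X then 1 else 0)"

text \<open>Square matrices indexed by a finite set \<open>V\<close>; only the entries at indices in \<open>V\<close> matter.\<close>

primrec matrix_power :: "'a set \<Rightarrow> ('a \<Rightarrow> 'a \<Rightarrow> complex) \<Rightarrow> nat \<Rightarrow> 'a \<Rightarrow> 'a \<Rightarrow> complex" where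
  "matrix_power V A 0 = (\<lambda>u v. if u = v then 1 else 0)"
| "matrix_power V A (Suc n) = (\<lambda>u v. \<Sum>w\<in>V. A u w * matrix_power V A n w v)"

definition matrix_exp :: "'a set \<Rightarrow> ('a \<Rightarrow> 'a \<Rightarrow> complex) \<Rightarrow> 'a \<Rightarrow> 'a \<Rightarrow> complex" where
  "matrix_exp V A u v = (\<Sum>n. matrix_power V A n u v / fact n)"

definition transition_matrix :: "'a pair_pre_digraph \<Rightarrow> real \<Rightarrow> 'a \<Rightarrow> 'a \<Rightarrow> complex" where
  "transition_matrix X t =
    matrix_exp (pverts X) (\<lambda>u v. \<i> * complex_of_real t * adjacency_matrix X u v)"

definition perfect_state_transfer_at :: "'a pair_pre_digraph \<Rightarrow> real \<Rightarrow> bool" where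
  "perfect_state_transfer_at X \<tau> \<longleftrightarrow>
    (\<exists>u\<in>pverts X. \<exists>v\<in>pverts X. u \<noteq> v \<and> cmod (transition_matrix X \<tau> u v) = 1)"

end

theory Submission
  imports
    Defs
    "HOL-Number_Theory.Cong"
    "HOL-Algebra.Multiplicative_Group"
begin

text \<open>
  Let \<open>a\<close> be the element of order two with the single nonzero coordinate \<open>m\<^sub>i / 2\<close>, for some even
  modulus \<open>m\<^sub>i\<close>. Both \<open>{0}\<close> and \<open>{a}\<close> are gcd classes, so the complement of \<open>{0, a}\<close> is a union of
  gcd classes. Its Cayley graph is the cocktail party graph, with adjacency matrix \<open>J - I - T\<close>, where
  \<open>J\<close> is the all-ones matrix and \<open>T\<close> the translation by \<open>a\<close>. These matrices commute, \<open>J\<^sup>2 = n J\<close> with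
  \<open>4\<close> dividing \<open>n\<close>, and \<open>T\<^sup>2 = I\<close>, hence at time \<open>\<pi> / 2\<close> the transition matrix is
  \<open>I \<cdot> (- \<i> I) \<cdot> (- \<i> T) = - T\<close>.

  For the existence of a cyclic decomposition, take \<open>x\<close> of maximal \<open>p\<close>-power order and a subgroup \<open>K\<close>
  maximal among those meeting \<open>\<langle>x\<rangle>\<close> trivially; then \<open>G\<close> is the direct product of \<open>\<langle>x\<rangle>\<close> and \<open>K\<close>.
\<close>

section \<open>Decomposition of finite abelian groups into cyclic groups\<close>

text \<open>With \<open>n\<close> the least positive exponent that brings \<open>y\<close> into
  \<open>L\<close> and \<open>q\<close> a prime factor of \<open>n\<close>, the power of
  \<open>y\<close> with exponent \<open>n div q\<close> is still outside \<open>L\<close> by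
  minimality, while its \<open>q\<close>-th power is inside.\<close>

lemma (in group) exists_prime_pow_in_subgroup:
  assumes "finite (carrier G)" "subgroup L G" "y \<in> carrier G" "y \<notin> L"
  obtains z q where "prime (q::nat)" "z \<in> carrier G" "z \<notin> L" "z [^] q \<in> L"
proof -
  have L1: "\<one> \<in> L" using assms(2) by (rule subgroup.one_closed)
  define n where "n = (LEAST n::nat. n > 0 \<and> y [^] n \<in> L)"
  have "ord y > 0" using ord_ge_1[OF assms(1,3)] by simp
  moreover have "y [^] ord y \<in> L" using L1 assms(3) by simp
  ultimately have "n > 0 \<and> y [^] n \<in> L" 
    unfolding n_def using LeastI[of "\<lambda>n. n > 0 \<and> y [^] n \<in> L" "ord y"] by blast
  then have n: "n > 0" "y [^] n \<in> L" by auto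
  have less: "y [^] k \<notin> L" if "0 < k" "k < n" for k
    using not_less_Least[of k "\<lambda>n. n > 0 \<and> y [^] n \<in> L"] that unfolding n_def by auto
  have "n \<noteq> 1" using n(2) assms(3,4) by (auto simp: nat_pow_eone)
  then obtain q where q: "prime q" "q dvd n" using prime_factor_nat by blast
  then obtain k where k: "n = k * q" by (metis dvdE mult.commute)
  have k0: "0 < k" "k < n" using k n(1) prime_gt_1_nat[OF q(1)] by auto
  show thesis
  proof (rule that[of q "y [^] k"])
    show "(y [^] k) [^] q \<in> L" using n(2) assms(3) by (simp add: k nat_pow_pow)
  qed (use q k0 less assms in auto)
qed

text \<open>Let \<open>C\<close> be generated by \<open>x\<close> and let \<open>K\<close> be
  maximal among the subgroups meeting \<open>C\<close> trivially. If their product \<open>L\<close>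
  were proper, some \<open>y\<close> outside \<open>L\<close> would have a \<open>q\<close>-th power
  in \<open>L\<close> with \<open>q\<close> prime. Maximality of \<open>ord x\<close> allows
  \<open>y\<close> to be corrected by a power of \<open>x\<close> to some \<open>z\<close> outside
  \<open>L\<close> whose \<open>q\<close>-th power lies in \<open>K\<close>. Adjoining
  \<open>z\<close> to \<open>K\<close> then contradicts the maximality of \<open>K\<close>.\<close>

lemma (in comm_group) cyclic_subgroup_complement:
  assumes fin: "finite (carrier G)" and p: "prime (p::nat)" and x: "x \<in> carrier G"
    and ordx: "ord x = p ^ e"
    and maxe: "\<And>y f. y \<in> carrier G \<Longrightarrow> ord y = p ^ f \<Longrightarrow> f \<le> e"
  obtains K where "subgroup K G" "K \<inter> range (\<lambda>n::int. x [^] n) = {\<one>}"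
    "range (\<lambda>n::int. x [^] n) <#> K = carrier G"
proof -
  define C where "C = range (\<lambda>n::int. x [^] n)"
  have C: "subgroup C G" unfolding C_def using x by (rule subgroup_of_powers)
  then interpret C: subgroup C G .
  define F where "F = {K. subgroup K G \<and> K \<inter> C = {\<one>}}"
  have "F \<subseteq> Pow (carrier G)" unfolding F_def by (auto dest: subgroup.subset)
  then have "finite F" using fin by (meson finite_Pow_iff finite_subset)
  moreover have "{\<one>} \<in> F" unfolding F_def using triv_subgroup by auto
  ultimately have "\<exists>K\<in>F. {\<one>} \<subseteq> K \<and> (\<forall>K'\<in>F. K \<subseteq> K' \<longrightarrow> K = K')"
    by (rule finite_has_maximal2)
  then obtain K where KF: "K \<in> F" and "\<forall>K'\<in>F. K \<subseteq> K' \<longrightarrow> K = K'"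
    by (elim bexE conjE)
  then have Kmax: "K = K'" if "K' \<in> F" "K \<subseteq> K'" for K' using that by simp
  from KF have K: "subgroup K G" and KC: "K \<inter> C = {\<one>}" unfolding F_def by simp_all
  interpret K: subgroup K G by fact
  define L where "L = C <#> K"
  have L: "subgroup L G" unfolding L_def using C K by (rule mult_subgroups)
  interpret L: subgroup L G by fact
  have CL: "C \<subseteq> L" 
  proof
    fix c assume "c \<in> C"
    then have "c = c \<otimes> \<one>" by simp
    with \<open>c \<in> C\<close> show "c \<in> L" unfolding L_def set_mult_def using K.one_closed by blast
  qed
  have KL: "K \<subseteq> L" 
  proof
    fix c assume "c \<in> K"
    then have "c = \<one> \<otimes> c" by simp
    with \<open>c \<in> K\<close> show "c \<in> L" unfolding L_def set_mult_def using C.one_closed by blast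
  qed
  have "L = carrier G"
  proof (rule ccontr)
    assume "L \<noteq> carrier G"
    then obtain y0 where "y0 \<in> carrier G" "y0 \<notin> L" using L.subset by auto
    then obtain y and q :: nat where q: "prime q" and y: "y \<in> carrier G" "y \<notin> L" and yq: "y [^] q \<in> L"
      by (rule exists_prime_pow_in_subgroup[OF fin L])
    obtain a :: int and k where k: "k \<in> K" and yqk: "y [^] q = x [^] a \<otimes> k"
      using yq unfolding L_def set_mult_def C_def by auto
    have kG: "k \<in> carrier G" using k by simp
    \<comment> \<open>The factor \<open>x [^] a\<close> has to be a \<open>q\<close>-th power inside
      \<open>C\<close>. Since \<open>ord x = p ^ e\<close>, this says that \<open>a\<close> is a
      multiple of \<open>q\<close> modulo \<open>p ^ e\<close>. For \<open>q \<noteq> p\<close> it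
      holds because \<open>q\<close> is invertible modulo \<open>p ^ e\<close>.\<close>
    have "\<exists>b. int (p ^ e) dvd int q * b - a"
    proof (cases "q = p")
      case False
      then have "coprime (int q) (int (p ^ e))"
        using primes_coprime[OF q p] by simp
      then obtain b where "[int q * b = 1] (mod int (p ^ e))"
        using cong_solve_coprime_int by blast
      then have "[int q * b * a = 1 * a] (mod int (p ^ e))" by (rule cong_scalar_right)
      then have "int (p ^ e) dvd int q * (b * a) - a" by (simp add: cong_iff_dvd_diff mult.assoc)
      then show ?thesis ..
    next
      case qp: True
      show ?thesis
      proof (cases e)
        case 0
        then show ?thesis by auto
      next
        case (Suc e')
        \<comment> \<open>The power \<open>y [^] r\<close> has order \<open>p ^ f\<close>, so
          \<open>f \<le> e\<close> and \<open>ord y\<close> divides \<open>p * (r * p ^ e')\<close>.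
          Raising \<open>y [^] p = x [^] a \<otimes> k\<close> to the exponent
          \<open>r * p ^ e'\<close> therefore puts a power of \<open>x\<close> into
          \<open>K \<inter> C\<close>, and its triviality forces \<open>p\<close> to divide
          \<open>a * r\<close>, hence \<open>a\<close>.\<close>
        obtain f r where ordy: "ord y = r * p ^ f" and r: "\<not> p dvd r"
          using prime_power_canonical[OF p, of "ord y"] ord_ge_1[OF fin y(1)] by auto
        have "r \<noteq> 0" using r by (metis dvd_0_right)
        then have "ord (y [^] r) = p ^ f" using ord_pow[OF y(1), of r] ordy by simp
        then have "f \<le> e" using maxe y(1) by blast
        then have "ord y dvd p * (r * p ^ e')"
          unfolding ordy using Suc by (metis dvd_refl le_imp_power_dvd mult.commute mult.left_commute mult_dvd_mono power_Suc)
        then have "(y [^] q) [^] (r * p ^ e') = \<one>"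
          using y(1) by (simp add: qp nat_pow_pow pow_eq_id)
        then have "\<one> = (y [^] q) [^] (r * p ^ e')" ..
        also have "\<dots> = (x [^] a) [^] (r * p ^ e') \<otimes> k [^] (r * p ^ e')"
          unfolding yqk using x kG by (simp add: nat_pow_distrib)
        also have "(x [^] a) [^] (r * p ^ e') = x [^] (a * int (r * p ^ e'))"
          using x by (simp add: int_pow_pow flip: int_pow_int)
        finally have eq: "x [^] (a * int (r * p ^ e')) \<otimes> k [^] (r * p ^ e') = \<one>" ..
        have kK: "k [^] (r * p ^ e') \<in> K"
          using k by (metis K subgroup_int_pow_closed int_pow_int)
        then have "x [^] (a * int (r * p ^ e')) = inv (k [^] (r * p ^ e'))"
          using eq x kG by (metis inv_equality int_pow_closed nat_pow_closed inv_inv)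
        then have "x [^] (a * int (r * p ^ e')) \<in> K" using kK by simp
        then have "x [^] (a * int (r * p ^ e')) \<in> K \<inter> C" unfolding C_def by blast
        then have "x [^] (a * int (r * p ^ e')) = \<one>" using KC by auto
        then have "int (p ^ e) dvd a * int (r * p ^ e')"
          using int_pow_eq_id[OF x] ordx by auto
        then have "int (p ^ e') * int p dvd int (p ^ e') * (a * int r)"
          by (simp add: Suc ac_simps)
        then have "int p dvd a * int r" using p by (simp add: prime_gt_0_nat)
        then have "int p dvd a" using p r prime_dvd_mult_iff[of "int p" a "int r"] by auto
        then obtain b where "a = int p * b" ..
        then show ?thesis using qp by (intro exI[of _ b]) simp
      qed
    qed
    then obtain b where "int (p ^ e) dvd int q * b - a" ..
    then have xa: "x [^] a = x [^] (int q * b)" using int_pow_eq[OF x] ordx by auto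
    \<comment> \<open>Dividing \<open>y\<close> by the \<open>q\<close>-th root
      \<open>x [^] b\<close> of \<open>x [^] a\<close> leaves \<open>z [^] q = k\<close> in
      \<open>K\<close>, while \<open>z\<close> stays in the coset of \<open>y\<close> modulo
      \<open>L\<close>.\<close>
    define z where "z = y \<otimes> x [^] (- b)"
    have zG: "z \<in> carrier G" unfolding z_def using x y by simp
    have "z [^] q = y [^] q \<otimes> (x [^] (- b)) [^] q"
      unfolding z_def using x y by (simp add: nat_pow_distrib)
    also have "(x [^] (- b)) [^] q = x [^] (- (int q * b))"
      using x by (simp add: int_pow_pow mult.commute flip: int_pow_int)
    also have "y [^] q \<otimes> x [^] (- (int q * b)) = k \<otimes> (x [^] (int q * b) \<otimes> x [^] (- (int q * b)))"
      unfolding yqk xa using x kG by (simp add: m_ac)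
    also have "\<dots> = k" using x kG by (simp flip: int_pow_mult)
    finally have zq: "z [^] q = k" .
    have zL: "z \<notin> L"
    proof
      assume "z \<in> L"
      moreover have "x [^] b \<in> L" using CL unfolding C_def by auto
      ultimately have "z \<otimes> x [^] b \<in> L" by simp
      also have "z \<otimes> x [^] b = y" unfolding z_def using x y
        by (simp add: m_assoc flip: int_pow_mult)
      finally show False using y by simp
    qed
    \<comment> \<open>This subgroup contains \<open>z\<close> and is strictly larger than
      \<open>K\<close>, so by maximality it meets \<open>C\<close> in some
      \<open>c \<noteq> \<one>\<close>.\<close>
    define K' where "K' = range (\<lambda>n::int. z [^] n) <#> K"
    have K': "subgroup K' G"
      unfolding K'_def by (rule mult_subgroups[OF subgroup_of_powers[OF zG] K])
    have KK': "K \<subseteq> K'"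
    proof
      fix c assume "c \<in> K"
      then have "c = z [^] (0::int) \<otimes> c" by simp
      with \<open>c \<in> K\<close> show "c \<in> K'" unfolding K'_def set_mult_def by blast
    qed
    have "z = z [^] (1::int) \<otimes> \<one>" using zG by simp
    then have zK': "z \<in> K'" unfolding K'_def set_mult_def using K.one_closed by blast
    have "K' \<inter> C \<noteq> {\<one>}"
    proof
      assume "K' \<inter> C = {\<one>}"
      then have "K = K'" using Kmax[of K'] K' KK' unfolding F_def by auto
      then show False using zK' zL KL by auto
    qed
    moreover have "\<one> \<in> K' \<inter> C" using subgroup.one_closed[OF K'] by auto
    ultimately obtain c where c: "c \<in> K'" "c \<in> C" "c \<noteq> \<one>" by blast
    then obtain j :: int and l where l: "l \<in> K" and cj: "c = z [^] j \<otimes> l"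
      unfolding K'_def set_mult_def by auto
    have zqint: "z [^] (int q * i) \<in> K" for i
      using zG k subgroup_int_pow_closed[OF K k, of i] zq by (metis int_pow_pow int_pow_int)
    \<comment> \<open>If \<open>q\<close> divides \<open>j\<close>, then \<open>z [^] j\<close> and
      with it \<open>c\<close> lie in \<open>K\<close>, against \<open>KC\<close>. Otherwise
      \<open>z [^] j\<close> and \<open>z [^] q\<close> both lie in \<open>L\<close>, and a Bezout
      combination of \<open>j\<close> and \<open>q\<close> puts \<open>z\<close> itself
      there.\<close>
    show False
    proof (cases "int q dvd j")
      case True
      then have "c \<in> K" using cj l zqint by (auto elim!: dvdE)
      then show False using c KC by auto
    next
      case False
      then have "coprime (int q) j" using q by (simp add: prime_imp_coprime)
      then obtain s t where st: "s * int q + t * j = 1"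
        by (metis bezout_int coprime_imp_gcd_eq_1)
      have "z [^] j = c \<otimes> inv l"
        unfolding cj using zG l by (simp add: m_assoc)
      then have "z [^] j \<in> L" using c l CL KL by auto
      then have 1: "z [^] (t * j) \<in> L"
        using subgroup_int_pow_closed[OF L, of "z [^] j" t] zG by (simp add: int_pow_pow mult.commute)
      have 2: "z [^] (s * int q) \<in> L" using zqint[of s] KL by (auto simp: mult.commute)
      have "z = z [^] (s * int q) \<otimes> z [^] (t * j)"
        using zG st by (simp flip: int_pow_mult)
      then show False using 1 2 zL L.m_closed by metis
    qed
  qed
  then show thesis using that[of K] K KC unfolding L_def C_def by auto
qed

text \<open>The group is the internal direct product of the cyclic group of \<open>x\<close> and
  \<open>K\<close>. Coordinate 0 is the exponent of \<open>x\<close>, and the remaining coordinates,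
  shifted down by one, are handed to \<open>\<psi>\<close>.\<close>

lemma (in comm_group) iso_product_group_Suc:
  assumes x: "x \<in> carrier G" "ord x = m" "m > 0" and K: "subgroup K G"
    and KC: "K \<inter> range (\<lambda>n::int. x [^] n) = {\<one>}"
    and CK: "range (\<lambda>n::int. x [^] n) <#> K = carrier G"
    and psi: "\<psi> \<in> iso (product_group {..<length ms} (\<lambda>i. integer_mod_group (ms ! i))) (G\<lparr>carrier := K\<rparr>)"
  shows "(\<lambda>f. x [^] f 0 \<otimes> \<psi> (\<lambda>i\<in>{..<length ms}. f (Suc i)))
    \<in> iso (product_group {..<length (m # ms)} (\<lambda>i. integer_mod_group ((m # ms) ! i))) G"
    (is "?h \<in> iso ?P G")
proof -
  interpret K: subgroup K G by fact
  let ?Q = "product_group {..<length ms} (\<lambda>i. integer_mod_group (ms ! i))"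
  let ?t = "\<lambda>f. \<lambda>i\<in>{..<length ms}. f (Suc i)"
  have t: "?t f \<in> carrier ?Q" if "f \<in> carrier ?P" for f :: "nat \<Rightarrow> int"
    using that by (auto simp: PiE_iff) (metis Suc_less_eq lessThan_iff nth_Cons_Suc)
  have psiK: "\<psi> g \<in> K" if "g \<in> carrier ?Q" for g
    using psi that by (auto simp: iso_iff hom_def)
  have psiG: "\<psi> g \<in> carrier G" if "g \<in> carrier ?Q" for g
    using psiK[OF that] by simp
  have psim: "\<psi> (g \<otimes>\<^bsub>?Q\<^esub> g') = \<psi> g \<otimes> \<psi> g'" if "g \<in> carrier ?Q" "g' \<in> carrier ?Q" for g g'
    using psi that by (auto simp: iso_iff hom_def simp del: mult_product_group carrier_product_group)
  have inj: "inj_on \<psi> (carrier ?Q)" and surj: "\<psi> ` carrier ?Q = K"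
    using psi by (auto simp: iso_iff)
  have f0: "0 \<le> f 0 \<and> f 0 < int m" if "f \<in> carrier ?P" for f :: "nat \<Rightarrow> int"
  proof -
    have "f 0 \<in> carrier (integer_mod_group ((m # ms) ! 0))"
      using that by (simp add: PiE_iff del: nth_Cons_0)
    then show ?thesis using x by (simp add: carrier_integer_mod_group)
  qed
  \<comment> \<open>Trivial intersection gives \<open>x [^] (a - b) = \<one>\<close>, so
    \<open>a\<close> and \<open>b\<close> agree modulo \<open>m\<close>; as standard representatives
    they are equal.\<close>
  have unique: "a = b \<and> k = l"
    if "x [^] a \<otimes> k = x [^] b \<otimes> l" "k \<in> K" "l \<in> K" "0 \<le> a" "a < int m" "0 \<le> b" "b < int m" for a b :: int and k l
  proof -
    have "x [^] (a - b) = l \<otimes> inv k"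
    proof -
      have "x [^] (a - b) = (x [^] a \<otimes> k) \<otimes> inv k \<otimes> x [^] (- b)"
        using that(2) x by (simp add: m_assoc flip: int_pow_mult)
      also have "\<dots> = (x [^] b \<otimes> x [^] (- b)) \<otimes> (l \<otimes> inv k)"
        unfolding that(1) using that(2,3) x by (simp add: m_ac)
      also have "\<dots> = l \<otimes> inv k" using that(2,3) x by (simp flip: int_pow_mult)
      finally show ?thesis .
    qed
    then have "x [^] (a - b) \<in> K" using that by simp
    then have "x [^] (a - b) \<in> K \<inter> range (\<lambda>n::int. x [^] n)" by blast
    then have "x [^] (a - b) = \<one>" using KC by auto
    then have "int m dvd a - b" using int_pow_eq_id x by auto
    then have "a = b" using that(4-7) by (metis mod_eq_dvd_iff mod_pos_pos_trivial)
    then show ?thesis using that x by auto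
  qed
  have hom: "?h \<in> hom ?P G"
  proof (rule homI)
    show "?h f \<in> carrier G" if "f \<in> carrier ?P" for f
      using psiG[OF t[OF that]] x by simp
    show "?h (f \<otimes>\<^bsub>?P\<^esub> g) = ?h f \<otimes> ?h g" if "f \<in> carrier ?P" "g \<in> carrier ?P" for f g
    proof -
      have "?t (f \<otimes>\<^bsub>?P\<^esub> g) = ?t f \<otimes>\<^bsub>?Q\<^esub> ?t g" by auto
      then have 1: "\<psi> (?t (f \<otimes>\<^bsub>?P\<^esub> g)) = \<psi> (?t f) \<otimes> \<psi> (?t g)"
        using psim[OF t t] that by presburger
      have "(f \<otimes>\<^bsub>?P\<^esub> g) 0 = (f 0 + g 0) mod int m" by simp
      then have "x [^] ((f \<otimes>\<^bsub>?P\<^esub> g) 0) = x [^] (f 0 + g 0)"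
        using int_pow_eq x by (simp add: mod_eq_dvd_iff[symmetric] del: mult_product_group)
      then have 2: "x [^] ((f \<otimes>\<^bsub>?P\<^esub> g) 0) = x [^] f 0 \<otimes> x [^] g 0" using x by (simp add: int_pow_mult)
      show ?thesis unfolding 1 2 using psiG[OF t] that x by (simp add: m_ac)
    qed
  qed
  have "inj_on ?h (carrier ?P)"
  proof (rule inj_onI)
    fix f g assume fg: "f \<in> carrier ?P" "g \<in> carrier ?P" "?h f = ?h g"
    then have "f 0 = g 0 \<and> \<psi> (?t f) = \<psi> (?t g)"
      using unique[OF fg(3)] psiK t f0 by blast
    then have 0: "f 0 = g 0" and "?t f = ?t g" using inj_onD[OF inj] t fg by blast+
    then have S: "f (Suc i) = g (Suc i)" if "i < length ms" for i
      using that by (metis lessThan_iff restrict_apply')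
    show "f = g"
    proof (rule PiE_ext)
      show "f \<in> PiE {..<length (m # ms)} (\<lambda>i. carrier (integer_mod_group ((m # ms) ! i)))"
        "g \<in> PiE {..<length (m # ms)} (\<lambda>i. carrier (integer_mod_group ((m # ms) ! i)))"
        using fg by auto
      show "f i = g i" if "i \<in> {..<length (m # ms)}" for i
        using 0 S that by (cases i) auto
    qed
  qed
  moreover have "?h ` carrier ?P = carrier G"
  proof
    show "?h ` carrier ?P \<subseteq> carrier G" using hom by (auto simp: hom_def)
    show "carrier G \<subseteq> ?h ` carrier ?P"
    proof
      fix y assume "y \<in> carrier G"
      then obtain a :: int and k where k: "k \<in> K" and y: "y = x [^] a \<otimes> k"
        using CK unfolding set_mult_def by blast
      obtain g where g: "g \<in> carrier ?Q" "k = \<psi> g" using surj k by blast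
      \<comment> \<open>The exponent \<open>a\<close> is an arbitrary integer; reducing it modulo
        \<open>m = ord x\<close> makes it a legal coordinate without changing the power of
        \<open>x\<close>.\<close>
      define f where "f = (\<lambda>i\<in>{..<length (m # ms)}. case i of 0 \<Rightarrow> a mod int m | Suc j \<Rightarrow> g j)"
      have fP: "f \<in> carrier ?P"
      proof -
        have "f i \<in> carrier (integer_mod_group ((m # ms) ! i))" if "i < length (m # ms)" for i
        proof (cases i)
          case 0
          then show ?thesis using x(3) by (simp add: f_def carrier_integer_mod_group)
        next
          case (Suc j)
          then show ?thesis using g(1) that by (auto simp: f_def PiE_iff)
        qed
        then show ?thesis by (auto simp: PiE_iff f_def)
      qed
      have "?t f = g" using g(1) by (auto simp: f_def PiE_iff extensional_def)
      moreover have "x [^] f 0 = x [^] a" 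
        using int_pow_eq x by (simp add: f_def mod_eq_dvd_iff[symmetric])
      ultimately have "?h f = y" using y g by simp
      then show "y \<in> ?h ` carrier ?P" using fP by blast
    qed
  qed
  ultimately show ?thesis using hom by (simp only: iso_iff)
qed

text \<open>Strong induction on the order: an element of maximal \<open>p\<close>-power order is
  split off, and the induction hypothesis applies to its complement. The isomorphism points from the
  product to the group because a new coordinate is then simply multiplied in; it is inverted
  afterwards.\<close>

lemma exists_iso_product_group:
  fixes G :: "('a, 'b) monoid_scheme"
  assumes "finite (carrier G)" "comm_group G"
  shows "\<exists>ms \<psi>. 0 \<notin> set ms \<and> \<psi> \<in> iso (product_group {..<length ms} (\<lambda>i. integer_mod_group (ms ! i))) G"
  using assms
proof (induction "order G" arbitrary: G rule: less_induct)
  case less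
  interpret comm_group G by fact
  show ?case
  proof (cases "carrier G = {\<one>\<^bsub>G\<^esub>}")
    case True
    then have "(\<lambda>_. \<one>\<^bsub>G\<^esub>) \<in> iso (product_group {..<length []} (\<lambda>i. integer_mod_group ([] ! i))) G"
      by (auto simp: iso_iff hom_def)
    then show ?thesis by (metis empty_iff list.set(1))
  next
    case False
    then obtain y where y: "y \<in> carrier G" "y \<noteq> \<one>\<^bsub>G\<^esub>" using one_closed by blast
    then have "ord y \<noteq> 1" using ord_eq_1 by auto
    then obtain p where p: "prime p" "p dvd ord y" using prime_factor_nat by blast
    have ordy: "ord y \<noteq> 0" using ord_ge_1[OF less.prems(1) y(1)] by simp
    define E where "E = {f. \<exists>x\<in>carrier G. ord x = p ^ f}"
    \<comment> \<open>An element of order exactly \<open>p\<close> shows \<open>1 \<in> E\<close>.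
      Hence \<open>e \<ge> 1\<close>, so \<open>x\<close> is nontrivial and the complement
      \<open>K\<close> is proper, as the induction requires.\<close>
    have "ord (y [^]\<^bsub>G\<^esub> (ord y div p)) = p ^ 1"
      using ord_pow[OF y(1), of "ord y div p"] p ordy
      by (auto elim!: dvdE)
    then have E1: "1 \<in> E" unfolding E_def using y by blast
    \<comment> \<open>The maximum of \<open>E\<close> exists because
      \<open>f < 2 ^ f \<le> p ^ f \<le> order G\<close>.\<close>
    have "f \<le> order G" if "f \<in> E" for f
    proof -
      from that obtain x where x: "x \<in> carrier G" "ord x = p ^ f" unfolding E_def by blast
      have "p ^ f \<le> order G" using ord_le_group_order[OF less.prems(1) x(1)] unfolding x(2) .
      then show ?thesis using less_exp[of f] power_mono[OF prime_ge_2_nat[OF p(1)], of f] by linarith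
    qed
    then have finE: "finite E" by (meson finite_nat_set_iff_bounded_le)
    define e where "e = Max E"
    have "e \<in> E" unfolding e_def using finE E1 by (intro Max_in) auto
    then obtain x where x: "x \<in> carrier G" "ord x = p ^ e" unfolding E_def by blast
    have max: "f \<le> e" if "y \<in> carrier G" "ord y = p ^ f" for y f
      unfolding e_def using that finE by (intro Max_ge) (auto simp: E_def)
    have "e \<ge> 1" unfolding e_def using finE E1 by (intro Max_ge)
    obtain K where K: "subgroup K G" and KC: "K \<inter> range (\<lambda>n::int. x [^]\<^bsub>G\<^esub> n) = {\<one>\<^bsub>G\<^esub>}"
      and CK: "range (\<lambda>n::int. x [^]\<^bsub>G\<^esub> n) <#>\<^bsub>G\<^esub> K = carrier G"
      by (rule cyclic_subgroup_complement[OF less.prems(1) p(1) x]) (erule (1) max)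
    have "x \<noteq> \<one>\<^bsub>G\<^esub>" using x \<open>e \<ge> 1\<close> prime_gt_1_nat[OF p(1)] ord_eq_1[of x] by auto
    moreover have "x \<in> range (\<lambda>n::int. x [^]\<^bsub>G\<^esub> n)" using x by (metis int_pow_1 rangeI)
    ultimately have "x \<notin> K" using KC by auto
    then have "K \<subset> carrier G" using x subgroup.subset[OF K] by auto
    then have "order (G\<lparr>carrier := K\<rparr>) < order G"
      using less.prems(1) by (simp add: order_def psubset_card_mono)
    moreover have "comm_group (G\<lparr>carrier := K\<rparr>)"
      using subgroup.subgroup_is_group[OF K is_group] subgroup.mem_carrier[OF K]
      by (auto intro!: group.group_comm_groupI m_comm)
    moreover have "finite (carrier (G\<lparr>carrier := K\<rparr>))"
      using \<open>K \<subset> carrier G\<close> less.prems(1) by (auto intro: finite_subset)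
    ultimately obtain ms \<psi> where ms: "0 \<notin> set ms"
      and psi: "\<psi> \<in> iso (product_group {..<length ms} (\<lambda>i. integer_mod_group (ms ! i))) (G\<lparr>carrier := K\<rparr>)"
      using less.hyps by blast
    have "p ^ e > 0" using prime_gt_0_nat[OF p(1)] by simp
    with iso_product_group_Suc[OF x this K KC CK psi] ms
    show ?thesis by (intro exI[of _ "p ^ e # ms"]) auto
  qed
qed

lemma (in comm_group) exists_cyclic_decomposition:
  assumes "finite (carrier G)"
  shows "\<exists>ms \<phi>. cyclic_decomposition G ms \<phi>"
proof -
  obtain ms \<psi> where ms: "0 \<notin> set ms"
    and psi: "\<psi> \<in> iso (product_group {..<length ms} (\<lambda>i. integer_mod_group (ms ! i))) G"
    using exists_iso_product_group[OF assms comm_group_axioms] by blast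
  have "group (product_group {..<length ms} (\<lambda>i. integer_mod_group (ms ! i)))" by simp
  from group.iso_set_sym[OF this psi] ms show ?thesis unfolding cyclic_decomposition_def by blast
qed

section \<open>State transfer on cocktail party graphs\<close>

text \<open>
  The three summands are the spectral decomposition of \<open>c (J - I - T)\<close>: the eigenprojections are
  \<open>J / n\<close>, \<open>(I + T) / 2 - J / n\<close> and \<open>(I - T) / 2\<close>.
\<close>

lemma matrix_power_cocktail_party:
  fixes \<sigma> :: "'a \<Rightarrow> 'a" and c :: complex
  assumes V: "finite V" "V \<noteq> {}"
    and \<sigma>: "\<And>v. v \<in> V \<Longrightarrow> \<sigma> v \<in> V" "\<And>v. v \<in> V \<Longrightarrow> \<sigma> (\<sigma> v) = v" "\<And>v. v \<in> V \<Longrightarrow> \<sigma> v \<noteq> v"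
    and A: "\<And>u v. u \<in> V \<Longrightarrow> v \<in> V \<Longrightarrow> A u v = (if u = v \<or> u = \<sigma> v then 0 else c)"
    and "u \<in> V" "v \<in> V"
  shows "matrix_power V A k u v =
      (c * (of_nat (card V) - 2)) ^ k / of_nat (card V)
    + (- 2 * c) ^ k * ((if u = v \<or> u = \<sigma> v then 1 / 2 else 0) - 1 / of_nat (card V))
    + 0 ^ k * (if u = v then 1 / 2 else if u = \<sigma> v then - 1 / 2 else 0)"
  using \<open>u \<in> V\<close>
proof (induction k arbitrary: u)
  case 0
  then show ?case using \<sigma> \<open>v \<in> V\<close> by auto
next
  case (Suc k)
  define n :: complex where "n = of_nat (card V)"
  have n: "n \<noteq> 0" unfolding n_def using V by simp
  \<comment> \<open>With the column \<open>v\<close> fixed, \<open>e\<close> and \<open>f\<close>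
    are the columns of \<open>(I + T) / 2\<close> and \<open>(I - T) / 2\<close>, invariant and
    sign-changing under \<open>\<sigma>\<close> respectively.\<close>
  define e where "e = (\<lambda>u. if u = v \<or> u = \<sigma> v then 1 / 2 else 0 :: complex)"
  define f where "f = (\<lambda>u. if u = v then 1 / 2 else if u = \<sigma> v then - 1 / 2 else 0 :: complex)"
  define M where "M = (\<lambda>u. (c * (n - 2)) ^ k / n + (- 2 * c) ^ k * (e u - 1 / n) + 0 ^ k * f u)"
  have M: "matrix_power V A k w v = M w" if "w \<in> V" for w
    using Suc.IH[OF that] unfolding M_def n_def e_def f_def .
  have v\<sigma>: "v \<noteq> \<sigma> v" using \<sigma>(3)[OF \<open>v \<in> V\<close>] by simp
  have se: "(\<Sum>w\<in>V. e w) = 1"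
  proof -
    have "(\<Sum>w\<in>V. e w) = (\<Sum>w\<in>V. (if w = v then 1 / 2 else 0) + (if w = \<sigma> v then 1 / 2 else 0))"
      using \<sigma> \<open>v \<in> V\<close> by (intro sum.cong) (use v\<sigma> in \<open>auto simp: e_def\<close>)
    then show ?thesis using V \<sigma> \<open>v \<in> V\<close> by (simp add: sum.distrib)
  qed
  have sf: "(\<Sum>w\<in>V. f w) = 0"
  proof -
    have "(\<Sum>w\<in>V. f w) = (\<Sum>w\<in>V. (if w = v then 1 / 2 else 0) + (if w = \<sigma> v then - 1 / 2 else 0))"
      using \<sigma> \<open>v \<in> V\<close> by (intro sum.cong) (use v\<sigma> in \<open>auto simp: f_def\<close>)
    then show ?thesis using V \<sigma> \<open>v \<in> V\<close> by (simp add: sum.distrib)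
  qed
  \<comment> \<open>Summing over the column applies \<open>J\<close>. Only the first summand
    survives: the entries of \<open>e\<close> sum to 1, which cancels \<open>n * (1 / n)\<close>,
    and those of \<open>f\<close> sum to 0.\<close>
  have "(\<Sum>w\<in>V. M w) = n * ((c * (n - 2)) ^ k / n) + (- 2 * c) ^ k * ((\<Sum>w\<in>V. e w) - n * (1 / n)) + 0 ^ k * (\<Sum>w\<in>V. f w)"
    unfolding M_def by (simp add: sum.distrib sum_subtractf n_def flip: sum_distrib_left)
  then have sM: "(\<Sum>w\<in>V. M w) = (c * (n - 2)) ^ k" using n by (simp add: se sf)
  have u\<sigma>: "u = \<sigma> w \<longleftrightarrow> w = \<sigma> u" if "w \<in> V" for w using \<sigma> that Suc.prems by metis
  have e\<sigma>: "e (\<sigma> u) = e u" and f\<sigma>: "f (\<sigma> u) = - f u"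
    using \<sigma> Suc.prems \<open>v \<in> V\<close> unfolding e_def f_def by (metis, smt (verit) add.inverse_inverse minus_divide_left neg_0_equal_iff_equal)
  \<comment> \<open>Row \<open>u\<close> of \<open>A\<close> is the constant \<open>c\<close> with
    the entries at \<open>u\<close> and \<open>\<sigma> u\<close> deleted.\<close>
  have "matrix_power V A (Suc k) u v
      = (\<Sum>w\<in>V. c * M w - (if w = u then c * M w else 0) - (if w = \<sigma> u then c * M w else 0))"
    unfolding matrix_power.simps
  proof (intro sum.cong refl)
    fix w assume w: "w \<in> V"
    have A': "A u w = (if w = u \<or> w = \<sigma> u then 0 else c)"
      unfolding A[OF Suc.prems w] u\<sigma>[OF w] by (rule if_cong) auto
    consider "w = u" | "w \<noteq> u" "w = \<sigma> u" | "w \<noteq> u" "w \<noteq> \<sigma> u" by blast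
    then show "A u w * matrix_power V A k w v =
        c * M w - (if w = u then c * M w else 0) - (if w = \<sigma> u then c * M w else 0)"
      unfolding M[OF w] A' using \<sigma>(3)[OF Suc.prems] by cases (simp_all only: if_True if_False, simp_all)
  qed
  also have "\<dots> = c * (c * (n - 2)) ^ k - c * M u - c * M (\<sigma> u)"
    using V Suc.prems \<sigma>(1)[of u] by (simp add: sum_subtractf sM sum_distrib_left[symmetric])
  also have "\<dots> = (c * (n - 2)) ^ Suc k / n + (- 2 * c) ^ Suc k * (e u - 1 / n) + 0 ^ Suc k * f u"
    unfolding M_def e\<sigma> f\<sigma> using n by (simp add: field_simps)
  finally show ?case unfolding n_def e_def f_def .
qed

text \<open>Each summand of the power formula is geometric in \<open>k\<close>, so the exponential
  series replaces the power of an eigenvalue by its exponential. The eigenvalue 0 contributes the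
  factor \<open>exp 0 = 1\<close>.\<close>

lemma matrix_exp_cocktail_party:
  fixes \<sigma> :: "'a \<Rightarrow> 'a" and c :: complex
  assumes V: "finite V" "V \<noteq> {}"
    and \<sigma>: "\<And>v. v \<in> V \<Longrightarrow> \<sigma> v \<in> V" "\<And>v. v \<in> V \<Longrightarrow> \<sigma> (\<sigma> v) = v" "\<And>v. v \<in> V \<Longrightarrow> \<sigma> v \<noteq> v"
    and A: "\<And>u v. u \<in> V \<Longrightarrow> v \<in> V \<Longrightarrow> A u v = (if u = v \<or> u = \<sigma> v then 0 else c)"
    and uv: "u \<in> V" "v \<in> V"
  shows "matrix_exp V A u v =
      exp (c * (of_nat (card V) - 2)) / of_nat (card V)
    + exp (- 2 * c) * ((if u = v \<or> u = \<sigma> v then 1 / 2 else 0) - 1 / of_nat (card V))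
    + (if u = v then 1 / 2 else if u = \<sigma> v then - 1 / 2 else 0)" (is "_ = exp ?x / ?n + exp ?y * ?e + ?f")
proof -
  have ex: "(\<lambda>k. z ^ k / fact k) sums exp z" for z :: complex
    using exp_converges[of z] by (simp add: scaleR_conv_of_real field_simps)
  have "(\<lambda>k. ?x ^ k / fact k * (1 / ?n) + ?y ^ k / fact k * ?e + 0 ^ k / fact k * ?f)
      sums (exp ?x * (1 / ?n) + exp ?y * ?e + exp 0 * ?f)"
    by (intro sums_add sums_mult2 ex)
  moreover have power: "matrix_power V A k u v = ?x ^ k / ?n + ?y ^ k * ?e + 0 ^ k * ?f" for k
    using assms by (rule matrix_power_cocktail_party)
  moreover have distrib: "(P / N + Y * r + Z * s) / F = P / F * (1 / N) + Y / F * r + Z / F * s"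
    for P N Y r Z s F :: complex
    by (simp add: add_divide_distrib)
  have "matrix_power V A k u v / fact k
      = ?x ^ k / fact k * (1 / ?n) + ?y ^ k / fact k * ?e + 0 ^ k / fact k * ?f" for k
    unfolding power distrib ..
  ultimately show ?thesis unfolding matrix_exp_def by (simp add: sums_iff)
qed

section \<open>The cocktail party graph as a Cayley graph\<close>

context comm_group
begin

text \<open>Translation by \<open>a\<close> thereby takes the role of the involution
  \<open>\<sigma>\<close> in the matrix computation.\<close>

lemma parcs_cayley_graph_cocktail_party:
  assumes "a \<in> carrier G"
  shows "(u, v) \<in> parcs (cayley_graph G (carrier G - {\<one>, a})) \<longleftrightarrow>
    u \<in> carrier G \<and> v \<in> carrier G \<and> u \<noteq> v \<and> u \<noteq> a \<otimes> v"
proof -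
  have "u \<otimes> inv v = \<one> \<longleftrightarrow> u = v" "u \<otimes> inv v = a \<longleftrightarrow> u = a \<otimes> v"
    if "u \<in> carrier G" "v \<in> carrier G"
    using that assms by (metis inv_equality inv_inv inv_closed r_inv, metis inv_solve_right)
  then show ?thesis by (auto simp: cayley_graph_def)
qed

lemma mult_involution:
  assumes "a \<in> carrier G" "a \<noteq> \<one>" "a \<otimes> a = \<one>" "v \<in> carrier G"
  shows "a \<otimes> (a \<otimes> v) = v" "a \<otimes> v \<noteq> v"
proof -
  have "a \<otimes> (a \<otimes> v) = (a \<otimes> a) \<otimes> v" using assms(1,4) by (simp only: m_assoc)
  then show "a \<otimes> (a \<otimes> v) = v" using assms(3,4) by simp
  show "a \<otimes> v \<noteq> v" using assms(1,2,4) by simp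
qed

text \<open>There are no loops because \<open>\<one>\<close> is left out of the connection set, and
  the arcs are symmetric because \<open>a\<close> is its own inverse.\<close>

lemma pair_graph_cocktail_party:
  assumes "finite (carrier G)" "a \<in> carrier G" "a \<noteq> \<one>" "a \<otimes> a = \<one>"
  shows "pair_graph (cayley_graph G (carrier G - {\<one>, a}))" (is "pair_graph ?X")
proof -
  note arc = parcs_cayley_graph_cocktail_party[OF assms(2)]
  have V: "pverts ?X = carrier G" by (simp add: cayley_graph_def)
  have sub: "parcs ?X \<subseteq> carrier G \<times> carrier G" using arc by auto
  show ?thesis
  proof
    show "fst e \<in> pverts ?X" "snd e \<in> pverts ?X" if "e \<in> parcs ?X" for e
      using that sub V by auto
    show "finite (pverts ?X)" using assms V by simp
    show "finite (parcs ?X)" using sub assms(1) by (meson finite_SigmaI finite_subset)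
    show "fst e \<noteq> snd e" if "e \<in> parcs ?X" for e
      using that arc by (cases e) auto
    show "symmetric (with_proj ?X)"
      unfolding symmetric_def with_proj_simps
      by (rule symI) (use mult_involution[OF assms(2-4)] arc in auto)
  qed
qed

text \<open>Vertices that are not adjacent are equal or differ by \<open>a\<close>. Any vertex
  \<open>w\<close> outside \<open>{v, a \<otimes> v}\<close> is then adjacent to both, and one
  exists because there are more than two vertices.\<close>

lemma connected_cocktail_party:
  assumes "finite (carrier G)" "a \<in> carrier G" "a \<noteq> \<one>" "a \<otimes> a = \<one>" "order G > 2"
  shows "Digraph_Component.connected (with_proj (cayley_graph G (carrier G - {\<one>, a})))"
    (is "Digraph_Component.connected (with_proj ?X)")
proof -
  note arc = parcs_cayley_graph_cocktail_party[OF assms(2)]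
  note inv = mult_involution[OF assms(2-4)]
  have V: "pverts ?X = carrier G" by (simp add: cayley_graph_def)
  have step: "(u, v) \<in> rtrancl_on (carrier G) ((parcs ?X)\<^sup>s)" if "(u, v) \<in> parcs ?X" for u v
    using that arc[of u v]
    by (intro rtrancl_on_into_rtrancl_on[OF rtrancl_on_refl]) (auto simp: symcl_def)
  have "(u, v) \<in> rtrancl_on (carrier G) ((parcs ?X)\<^sup>s)" if uv: "u \<in> carrier G" "v \<in> carrier G" for u v
  proof (cases "u = v \<or> u = a \<otimes> v")
    case False
    then show ?thesis using step arc uv by blast
  next
    case True
    have "card {v, a \<otimes> v} \<le> 2" by (simp add: card_insert_if)
    then have "\<not> carrier G \<subseteq> {v, a \<otimes> v}"
      using card_mono[of "{v, a \<otimes> v}" "carrier G"] assms(5) by (auto simp: order_def)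
    then obtain w where w: "w \<in> carrier G" "w \<noteq> v" "w \<noteq> a \<otimes> v" by blast
    have "a \<otimes> w \<noteq> v" using inv(1)[OF w(1)] w(3) by metis
    moreover have "a \<otimes> w \<noteq> a \<otimes> v" using w uv assms(2) by simp
    ultimately have "(u, w) \<in> parcs ?X" and "(w, v) \<in> parcs ?X"
      unfolding arc using True w uv by auto
    then show ?thesis by (intro rtrancl_on_trans[OF step step])
  qed
  then show ?thesis unfolding connected_conv with_proj_simps V by auto
qed

text \<open>Transfer takes place between \<open>a\<close> and \<open>\<one>\<close>. Both nonzero
  eigenvalues exponentiate to -1, so the entry is
  \<open>- 1 / n - (1 / 2 - 1 / n) - 1 / 2 = - 1\<close>.\<close>

lemma perfect_state_transfer_cocktail_party:
  assumes "finite (carrier G)" "a \<in> carrier G" "a \<noteq> \<one>" "a \<otimes> a = \<one>" "order G mod 4 = 0"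
  shows "perfect_state_transfer_at (cayley_graph G (carrier G - {\<one>, a})) (pi / 2)"
    (is "perfect_state_transfer_at ?X _")
proof -
  note arc = parcs_cayley_graph_cocktail_party[OF assms(2)]
  note inv = mult_involution[OF assms(2-4)]
  define c where "c = \<i> * complex_of_real (pi / 2)"
  define n :: complex where "n = of_nat (order G)"
  obtain m where m: "order G = 4 * m" using assms(5) by auto
  have V: "pverts ?X = carrier G" by (simp add: cayley_graph_def)
  have "transition_matrix ?X (pi / 2) a \<one> = exp (c * (n - 2)) / n + exp (- 2 * c) * (1 / 2 - 1 / n) - 1 / 2"
    unfolding transition_matrix_def V
    using assms(1-3) inv
    by (subst matrix_exp_cocktail_party[where \<sigma> = "\<lambda>v. a \<otimes> v" and c = c])
       (auto simp: adjacency_matrix_def arc c_def n_def order_def)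
  also have "exp (c * (n - 2)) = - 1"
  proof -
    \<comment> \<open>Divisibility of the order by 4 enters here: it makes \<open>c * n\<close> a
      multiple of \<open>2 * pi * \<i>\<close>.\<close>
    have "c * (n - 2) = of_nat m * (2 * of_real pi * \<i>) - of_real pi * \<i>"
      unfolding c_def n_def m by (simp add: field_simps)
    then show ?thesis by (simp only: exp_diff exp_of_nat_mult exp_two_pi_i exp_pi_i) simp
  qed
  also have "exp (- 2 * c) = - 1"
    unfolding c_def by (simp add: exp_minus exp_pi_i' )
  finally have "transition_matrix ?X (pi / 2) a \<one> = - 1" by (simp add: algebra_simps)
  then show ?thesis
    unfolding perfect_state_transfer_at_def V using assms(2,3)
    by (intro bexI[of _ a] bexI[of _ "\<one>"]) auto
qed

end

section \<open>Gcd classes of the identity and of an involution\<close>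

text \<open>The order of the group is the product of the moduli, and the prime 2 divides one of the
  factors.\<close>

lemma even_modulus_of_cyclic_decomposition:
  assumes "cyclic_decomposition G ms \<phi>" "even (order G)"
  obtains i where "i < length ms" "even (ms ! i)"
proof -
  have ms: "ms ! i \<noteq> 0" if "i < length ms" for i
    using assms(1) that by (metis cyclic_decomposition_def nth_mem)
  have "order G = card (carrier (product_group {..<length ms} (\<lambda>i. integer_mod_group (ms ! i))))"
    using assms(1) iso_same_card is_isoI unfolding cyclic_decomposition_def order_def by blast
  also have "\<dots> = (\<Prod>i<length ms. ms ! i)"
    using ms by (auto simp: card_PiE carrier_integer_mod_group intro!: prod.cong)
  finally have "even (\<Prod>i<length ms. ms ! i)" using assms(2) by simp
  then obtain i where "i < length ms" "even (ms ! i)"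
    using prime_dvd_prod_iff[of "{..<length ms}" 2 "\<lambda>i. ms ! i"] by auto
  then show thesis by (rule that)
qed

lemma gcd_eq_self_iff:
  fixes y m :: int
  assumes "0 \<le> y" "y < m"
  shows "gcd y m = m \<longleftrightarrow> y = 0"
proof
  assume "gcd y m = m"
  then have "m dvd y" by (metis gcd_dvd1)
  then show "y = 0" using assms zdvd_not_zless[of y m] by fastforce
qed (use assms in simp)

text \<open>A gcd of \<open>m div 2\<close> makes \<open>y\<close> a multiple
  \<open>m div 2 * k\<close>, and the bounds leave \<open>k = 0\<close> or \<open>k = 1\<close>. The
  former is excluded because \<open>gcd 0 m = m\<close>.\<close>

lemma gcd_eq_half_iff:
  fixes y m :: int
  assumes "0 \<le> y" "y < m" "even m"
  shows "gcd y m = m div 2 \<longleftrightarrow> y = m div 2"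
proof
  assume g: "gcd y m = m div 2"
  then have "m div 2 dvd y" by (metis gcd_dvd1)
  then obtain k where k: "y = m div 2 * k" ..
  obtain h where h: "m = 2 * h" using assms(3) by auto
  have "h > 0" using assms h by auto
  have "y = h * k" using k h by simp
  then have "0 \<le> h * k" "h * k < h * 2" using assms h by linarith+
  then have "k \<ge> 0" "k < 2"
    using \<open>h > 0\<close> by (simp_all only: zero_le_mult_iff mult_less_cancel_left_pos) auto
  moreover have "k \<noteq> 0" using g k h \<open>h > 0\<close> by auto
  ultimately have "k = 1" by simp
  then show "y = m div 2" using k by simp
next
  assume "y = m div 2"
  then show "gcd y m = m div 2" using assms by (auto elim!: evenE)
qed

text \<open>The set \<open>D\<close> consists of all divisor tuples but two, namely those whose
  classes are the singletons of \<open>\<one>\<close> and of \<open>a\<close>.\<close>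

lemma (in comm_group) gcd_graph_cocktail_party:
  assumes dec: "cyclic_decomposition G ms \<phi>" and even: "even (order G)"
  obtains a D where "a \<in> carrier G" "a \<noteq> \<one>" "a \<otimes> a = \<one>" "D \<subseteq> divisor_tuples ms"
    "gcd_graph G ms \<phi> D = cayley_graph G (carrier G - {\<one>, a})"
proof -
  let ?N = "{..<length ms}"
  let ?P = "product_group ?N (\<lambda>i. integer_mod_group (ms ! i))"
  have ms: "ms ! i \<noteq> 0" if "i < length ms" for i
    using dec that by (metis cyclic_decomposition_def nth_mem)
  have "group ?P" by simp
  have iso: "\<phi> \<in> iso G ?P" using dec by (simp add: cyclic_decomposition_def)
  then have hom: "group_hom G ?P \<phi>"
    using \<open>group ?P\<close> by (simp add: group_hom_def group_hom_axioms_def iso_iff)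
  have inj: "\<phi> x = \<phi> y \<longleftrightarrow> x = y" if "x \<in> carrier G" "y \<in> carrier G" for x y
    using iso that by (auto simp: iso_iff inj_on_def)
  have carr: "\<phi> x \<in> carrier ?P" if "x \<in> carrier G" for x
    using iso that by (auto simp: iso_iff hom_def)
  have range: "0 \<le> \<phi> x j \<and> \<phi> x j < int (ms ! j)" if "x \<in> carrier G" "j < length ms" for x j
    using carr[OF that(1)] ms[OF that(2)] that(2)
    by (auto simp: PiE_iff carrier_integer_mod_group dest!: bspec[of _ _ j])
  obtain i where i: "i < length ms" "even (ms ! i)"
    using even_modulus_of_cyclic_decomposition[OF dec even] .
  \<comment> \<open>These are the coordinates of the involution \<open>a\<close>: half the modulus
    at one even place, zero elsewhere.\<close>
  define g where "g = (\<lambda>j\<in>?N. if j = i then int (ms ! i) div 2 else 0)"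
  have half: "int (ms ! i) div 2 + int (ms ! i) div 2 = int (ms ! i)" "0 < int (ms ! i) div 2"
    using i ms[of i] by (auto elim!: evenE)
  have gP: "g \<in> carrier ?P"
    using half ms unfolding g_def by (auto simp: carrier_integer_mod_group)
  then have "g \<in> \<phi> ` carrier G" using iso by (metis iso_iff)
  then obtain a where a: "a \<in> carrier G" "\<phi> a = g" by blast
  have one: "\<phi> \<one> = (\<lambda>j\<in>?N. 0)" using group_hom.hom_one[OF hom] by simp
  have "g i \<noteq> (\<lambda>j\<in>?N. 0) i" using i half by (simp add: g_def)
  then have a1: "a \<noteq> \<one>" using a one by auto
  have "\<phi> (a \<otimes> a) = g \<otimes>\<^bsub>?P\<^esub> g" using group_hom.hom_mult[OF hom a(1) a(1)] a(2) by simp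
  also have "\<dots> = \<phi> \<one>" unfolding one by (rule ext) (use half in \<open>auto simp: g_def\<close>)
  finally have aa: "a \<otimes> a = \<one>" using inj a(1) by simp
  \<comment> \<open>Since \<open>gcd 0 m = m\<close>, the gcd tuple of the identity is
    \<open>ms\<close> itself; that of \<open>a\<close> differs from it only at \<open>i\<close>,
    where the gcd is half the modulus.\<close>
  define ds where "ds = ms[i := ms ! i div 2]"
  have eqI: "\<phi> x = h" if "x \<in> carrier G" "h \<in> carrier ?P" "\<And>j. j < length ms \<Longrightarrow> \<phi> x j = h j" for x h
    using carr[OF that(1)] that(2,3)
    by (intro PiE_ext[of "\<phi> x" ?N "\<lambda>i. carrier (integer_mod_group (ms ! i))" h]) simp_all
  have class_ms: "x \<in> gcd_class G ms \<phi> ms \<longleftrightarrow> x = \<one>" if x: "x \<in> carrier G" for x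
  proof -
    have "x \<in> gcd_class G ms \<phi> ms \<longleftrightarrow> (\<forall>j<length ms. \<phi> x j = 0)"
      using x gcd_eq_self_iff range by (simp add: gcd_class_def)
    also have "\<dots> \<longleftrightarrow> \<phi> x = \<phi> \<one>"
      using eqI[OF x carr[OF one_closed]] by (auto simp: one)
    finally show ?thesis using inj x by simp
  qed
  have class_ds: "x \<in> gcd_class G ms \<phi> ds \<longleftrightarrow> x = a" if x: "x \<in> carrier G" for x
  proof -
    have "gcd (\<phi> x j) (int (ms ! j)) = int (ds ! j) \<longleftrightarrow> \<phi> x j = g j" if j: "j < length ms" for j
    proof (cases "j = i")
      case True
      have "gcd (\<phi> x j) (int (ms ! j)) = int (ms ! j) div 2 \<longleftrightarrow> \<phi> x j = int (ms ! j) div 2"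
        by (rule gcd_eq_half_iff) (use range[OF x j] i True in simp_all)
      moreover have "int (ds ! j) = int (ms ! j) div 2" using True i by (simp add: ds_def zdiv_int)
      moreover have "g j = int (ms ! j) div 2" using True i by (simp add: g_def)
      ultimately show ?thesis by (simp only:)
    next
      case False
      have "gcd (\<phi> x j) (int (ms ! j)) = int (ms ! j) \<longleftrightarrow> \<phi> x j = 0"
        by (rule gcd_eq_self_iff) (use range[OF x j] in simp_all)
      moreover have "ds ! j = ms ! j" using False by (simp add: ds_def)
      moreover have "g j = 0" using False j by (simp add: g_def)
      ultimately show ?thesis by (simp only:)
    qed
    then have "x \<in> gcd_class G ms \<phi> ds \<longleftrightarrow> (\<forall>j<length ms. \<phi> x j = g j)"
      using x by (simp add: gcd_class_def)
    also have "\<dots> \<longleftrightarrow> \<phi> x = \<phi> a" using eqI[OF x gP] a by auto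
    finally show ?thesis using inj[OF x a(1)] by simp
  qed
  have sub: "gcd_class G ms \<phi> d \<subseteq> carrier G" for d by (auto simp: gcd_class_def)
  \<comment> \<open>The gcd classes partition the group: \<open>x\<close> lies in the class of its
    own gcd tuple \<open>t\<close> and in that of no other tuple of the same length. Leaving out
    \<open>ms\<close> and \<open>ds\<close> thus removes exactly their two classes.\<close>
  have rest: "(\<exists>d\<in>divisor_tuples ms - {ms, ds}. x \<in> gcd_class G ms \<phi> d)
      \<longleftrightarrow> x \<notin> gcd_class G ms \<phi> ms \<and> x \<notin> gcd_class G ms \<phi> ds" if x: "x \<in> carrier G" for x
  proof -
    define t where "t = map (\<lambda>j. nat (gcd (\<phi> x j) (int (ms ! j)))) [0..<length ms]"
    have len: "length t = length ms" by (simp add: t_def)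
    have class_iff: "x \<in> gcd_class G ms \<phi> d \<longleftrightarrow> d = t" if "length d = length ms" for d
    proof -
      have "gcd (\<phi> x j) (int (ms ! j)) = int (d ! j) \<longleftrightarrow> d ! j = t ! j" if "j < length ms" for j
        using that by (auto simp: t_def)
      then show ?thesis using that x by (simp add: gcd_class_def list_eq_iff_nth_eq len)
    qed
    have "t \<in> divisor_tuples ms"
      using len by (simp add: t_def divisor_tuples_def nat_dvd_iff)
    moreover have "length d = length ms" if "d \<in> divisor_tuples ms" for d
      using that by (simp add: divisor_tuples_def)
    moreover have "length ds = length ms" by (simp add: ds_def)
    ultimately show ?thesis using class_iff by blast
  qed
  have "(\<Union>d\<in>divisor_tuples ms - {ms, ds}. gcd_class G ms \<phi> d) = carrier G - {\<one>, a}"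
  proof (rule Set.set_eqI)
    fix x
    show "x \<in> (\<Union>d\<in>divisor_tuples ms - {ms, ds}. gcd_class G ms \<phi> d) \<longleftrightarrow> x \<in> carrier G - {\<one>, a}"
    proof (cases "x \<in> carrier G")
      case True
      then show ?thesis unfolding UN_iff rest[OF True] class_ms[OF True] class_ds[OF True] by simp
    next
      case False
      then show ?thesis using sub by blast
    qed
  qed
  then have "gcd_graph G ms \<phi> (divisor_tuples ms - {ms, ds}) = cayley_graph G (carrier G - {\<one>, a})"
    by (simp only: gcd_graph_def)
  then show thesis by (rule that[OF a(1) a1 aa Diff_subset])
qed

text \<open>Gcd-graphs are defined relative to a cyclic decomposition, so the graph is provided for
  every decomposition; the separate existence claim keeps this from being vacuous.\<close>

theorem theorem4p14:
  fixes G :: "('a, 'b) monoid_scheme"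
  assumes "comm_group G" and "finite (carrier G)" and "order G mod 4 = 0"
  shows "(\<exists>ms \<phi>. cyclic_decomposition G ms \<phi>) \<and>
    (\<forall>ms \<phi>. cyclic_decomposition G ms \<phi> \<longrightarrow>
      (\<exists>D \<subseteq> divisor_tuples ms.
        pair_graph (gcd_graph G ms \<phi> D) \<and>
        Digraph_Component.connected (with_proj (gcd_graph G ms \<phi> D)) \<and>
        perfect_state_transfer_at (gcd_graph G ms \<phi> D) (pi / 2)))"
proof -
  interpret comm_group G by fact
  have "\<exists>D \<subseteq> divisor_tuples ms.
        pair_graph (gcd_graph G ms \<phi> D) \<and>
        Digraph_Component.connected (with_proj (gcd_graph G ms \<phi> D)) \<and>
        perfect_state_transfer_at (gcd_graph G ms \<phi> D) (pi / 2)"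
    if dec: "cyclic_decomposition G ms \<phi>" for ms \<phi>
  proof -
    have "even (order G)" using assms(3) by presburger
    have "order G > 0" using assms(2) by (simp add: order_gt_0_iff_finite)
    then have "order G > 2" using assms(3) by presburger
    obtain a D where a: "a \<in> carrier G" "a \<noteq> \<one>\<^bsub>G\<^esub>" "a \<otimes>\<^bsub>G\<^esub> a = \<one>\<^bsub>G\<^esub>" and D: "D \<subseteq> divisor_tuples ms"
      and X: "gcd_graph G ms \<phi> D = cayley_graph G (carrier G - {\<one>\<^bsub>G\<^esub>, a})"
      using gcd_graph_cocktail_party[OF dec \<open>even (order G)\<close>] .
    show ?thesis
      using D pair_graph_cocktail_party[OF assms(2) a]
        connected_cocktail_party[OF assms(2) a \<open>order G > 2\<close>]
        perfect_state_transfer_cocktail_party[OF assms(2) a assms(3)]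
      unfolding X[symmetric] by blast
  qed
  then show ?thesis using exists_cyclic_decomposition[OF assms(2)] by blast
qed

end
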